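(* Let $X$ be a real reflexive Banach space such that both $X$ and $X^*$ are locally uniformly convex, let $A:X\supset D(A)\to 2^{X^*}$ be a maximal monotone operator, and let $\varphi$ be an arbitrary gauge function. Then the mappings $(\lambda,x)\mapsto A^\varphi_\lambda x$ from $(0,\infty)\times X$ to $X^*$ and $(\lambda,x)\mapsto J^\varphi_\lambda x$ from $(0,\infty)\times X$ to $X$ are continuous (with respect to the norm topologies).
   Context: A gauge function is a strictly increasing continuous $\varphi:[0,\infty)\to[0,\infty)$ with $\varphi(0)=0$, $\varphi(r)\to\infty$ as $r\to\infty$; $J_\varphi:X\to X^*$ is the duality mapping $J_\varphi x$ = the unique $x^*\in X^*$ with $\langle x^*,x\rangle=\varphi(\|x\|)\|x\|$, $\|x^*\|=\varphi(\|x\|)$ (single-valued here, and a bijection of $X$ onto $X^*$ whose inverse is the duality mapping of $X^*$ with gauge $\varphi^{-1}$). A space is locally uniformly convex if for every $x_0$ with $\|x_0\|=1$ and $\varepsilon\in(0,2]$ there is $\delta>0$ such that $\|x\|=1$, $\|x-x_0\|\ge\varepsilon$ imply $\|x+x_0\|\le2(1-\delta)$. $A$ is maximal monotone: $\langle u-v,x-y\rangle\ge0$ for $u\in Ax$, $v\in Ay$, and its graph is maximal among graphs of monotone operators. For $\lambda>0$ and $x\in X$, the inclusion $0\in J_\varphi(x_\lambda-x)+\lambda A x_\lambda$ has a unique solution $x_\lambda\in D(A)$; the generalized resolvent and Yosida approximant are defined by $J^\varphi_\lambda x:=x_\lambda$ and $A^\varphi_\lambda x:=\frac1\lambda J_\varphi(x-J^\varphi_\lambda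 x)$. Thus $A^\varphi_\lambda x\in A(J^\varphi_\lambda x)$ and $x=J^\varphi_\lambda x+J_\varphi^{-1}(\lambda A^\varphi_\lambda x)$. *)

theory Defs
  imports "HOL-Analysis.Analysis"
begin

definition gauge_function :: "(real \<Rightarrow> real) \<Rightarrow> bool" where
  "gauge_function \<phi> \<longleftrightarrow> strict_mono_on {0..} \<phi> \<and> continuous_on {0..} \<phi> \<and>
     \<phi> 0 = 0 \<and> filterlim \<phi> at_top at_top"

definition reflexive_space :: "'a::real_normed_vector itself \<Rightarrow> bool" where
  "reflexive_space _ \<longleftrightarrow>
     (\<forall>F :: ('a \<Rightarrow>\<^sub>L real) \<Rightarrow>\<^sub>L real. \<exists>x::'a. \<forall>g. blinfun_apply F g = blinfun_apply g x)"

definition locally_uniformly_convex :: "'a::real_normed_vector itself \<Rightarrow> bool" where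
  "locally_uniformly_convex _ \<longleftrightarrow>
     (\<forall>x0::'a. \<forall>\<epsilon>. norm x0 = 1 \<and> 0 < \<epsilon> \<and> \<epsilon> \<le> 2 \<longrightarrow>
        (\<exists>\<delta>>0. \<forall>x::'a. norm x = 1 \<and> norm (x - x0) \<ge> \<epsilon> \<longrightarrow> norm (x + x0) \<le> 2 * (1 - \<delta>)))"

definition monotone_op :: "('a::real_normed_vector \<Rightarrow> ('a \<Rightarrow>\<^sub>L real) set) \<Rightarrow> bool" where
  "monotone_op A \<longleftrightarrow>
     (\<forall>x y u v. u \<in> A x \<longrightarrow> v \<in> A y \<longrightarrow> blinfun_apply (u - v) (x - y) \<ge> 0)"

definition maximal_monotone :: "('a::real_normed_vector \<Rightarrow> ('a \<Rightarrow>\<^sub>L real) set) \<Rightarrow> bool" where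
  "maximal_monotone A \<longleftrightarrow> monotone_op A \<and>
     (\<forall>x u. (\<forall>y v. v \<in> A y \<longrightarrow> blinfun_apply (u - v) (x - y) \<ge> 0) \<longrightarrow> u \<in> A x)"

text \<open>Duality mapping with gauge \<phi> (single-valued under the standing assumptions).\<close>
definition duality_map :: "(real \<Rightarrow> real) \<Rightarrow> 'a::real_normed_vector \<Rightarrow> ('a \<Rightarrow>\<^sub>L real)" where
  "duality_map \<phi> x = (THE xs. blinfun_apply xs x = \<phi> (norm x) * norm x \<and> norm xs = \<phi> (norm x))"

definition gen_resolvent ::
  "('a::real_normed_vector \<Rightarrow> ('a \<Rightarrow>\<^sub>L real) set) \<Rightarrow> (real \<Rightarrow> real) \<Rightarrow> real \<Rightarrow> 'a \<Rightarrow> 'a" where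
  "gen_resolvent A \<phi> l x = (THE y. \<exists>u \<in> A y. duality_map \<phi> (y - x) + l *\<^sub>R u = 0)"

definition gen_yosida ::
  "('a::real_normed_vector \<Rightarrow> ('a \<Rightarrow>\<^sub>L real) set) \<Rightarrow> (real \<Rightarrow> real) \<Rightarrow> real \<Rightarrow> 'a \<Rightarrow> ('a \<Rightarrow>\<^sub>L real)" where
  "gen_yosida A \<phi> l x = (1 / l) *\<^sub>R duality_map \<phi> (x - gen_resolvent A \<phi> l x)"

end

theory Submission
  imports Defs
begin

text \<open>Resolvents exist because every monotone graph, lifted by the duality product, has its convex
  hull above the product, hence above the concave function \<open>(x, f) \<mapsto> - \<Phi> \<parallel>x\<parallel> - \<Phi>\<^sup>* \<parallel>f\<parallel>\<close>, where
  \<open>\<Phi>\<close> is the primitive of the gauge. Hahn--Banach puts an affine function in between; by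
  reflexivity it is given by a point \<open>(w, w')\<close>, which maximality places in the graph, and equality in
  Young's inequality says that \<open>- w'\<close> is the dual of \<open>w\<close>. (This is the argument of Simons and
  Zalinescu.)

  For continuity put \<open>z = x - J\<^sub>\<lambda> x\<close>. Monotonicity of \<open>A\<close> along a sequence \<open>(\<lambda>\<^sub>n, x\<^sub>n)\<close> first bounds
  \<open>\<parallel>z\<^sub>n\<parallel>\<close> and then makes \<open>\<langle>J z\<^sub>n - J z, z\<^sub>n - z\<rangle>\<close> tend to \<open>0\<close>. This quantity is a sum of three
  nonnegative terms, so that \<open>\<parallel>z\<^sub>n\<parallel> \<rightarrow> \<parallel>z\<parallel>\<close>, \<open>\<langle>J z, z\<^sub>n\<rangle> \<rightarrow> \<langle>J z, z\<rangle>\<close> and \<open>\<langle>J z\<^sub>n, z\<rangle> \<rightarrow> \<langle>J z, z\<rangle>\<close>; local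
  uniform convexity of the space and of its dual turns this into norm convergence.\<close>

section \<open>Linear minorants of convex cones\<close>

text \<open>Homogeneity is asked only as an inequality for \<open>c > 0\<close>; the inequality for
  \<open>1 / c\<close> reverses it, and \<open>c = 1 / 2\<close> together with subadditivity settles
  the value at \<open>0\<close>.\<close>

definition sublinear :: "('a::real_vector \<Rightarrow> real) \<Rightarrow> bool" where
  "sublinear p \<longleftrightarrow> (\<forall>x y. p (x + y) \<le> p x + p y) \<and> (\<forall>c>0. \<forall>x. p (c *\<^sub>R x) \<le> c * p x)"

lemma sublinear_add: "sublinear p \<Longrightarrow> p (x + y) \<le> p x + p y"
  by (simp add: sublinear_def)

lemma sublinear_zero:
  assumes "sublinear p"
  shows "p 0 = 0"
proof -
  have "p (0 + 0) \<le> p 0 + p 0" using assms by (rule sublinear_add)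
  moreover have "p ((1/2) *\<^sub>R 0) \<le> (1/2) * p 0"
    using assms unfolding sublinear_def by (meson half_gt_zero_iff zero_less_one)
  ultimately show ?thesis by simp
qed

lemma sublinear_scale:
  assumes "sublinear p" and "c \<ge> 0"
  shows "p (c *\<^sub>R x) = c * p x"
proof (cases "c = 0")
  case True
  then show ?thesis using sublinear_zero[OF assms(1)] by simp
next
  case False
  then have c: "c > 0" using assms(2) by simp
  have le: "\<And>d y. d > 0 \<Longrightarrow> p (d *\<^sub>R y) \<le> d * p y"
    using assms(1) by (simp add: sublinear_def)
  have "p ((1/c) *\<^sub>R (c *\<^sub>R x)) \<le> (1/c) * p (c *\<^sub>R x)"
    using c by (intro le) simp
  then have "c * p x \<le> p (c *\<^sub>R x)"
    using c by (simp add: field_simps)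
  with le[OF c, of x] show ?thesis by simp
qed

text \<open>A stand-in for the epigraph of a sublinear function. The third condition makes every
  fibre nonempty; the last one, applied to the sum of a point over \<open>w\<close> and one over
  \<open>- w\<close>, bounds the fibre below.\<close>

definition dominating_cone :: "('a::real_vector \<times> real) set \<Rightarrow> bool" where
  "dominating_cone K \<longleftrightarrow>
     (\<forall>a b. a \<in> K \<longrightarrow> b \<in> K \<longrightarrow> a + b \<in> K) \<and> (\<forall>c>0. \<forall>a\<in>K. c *\<^sub>R a \<in> K) \<and>
     (\<forall>w. \<exists>\<eta>. (w, \<eta>) \<in> K) \<and> (\<forall>\<eta>. (0, \<eta>) \<in> K \<longrightarrow> 0 \<le> \<eta>)"

lemma sublinear_minorant:
  assumes "dominating_cone K"
  obtains p where "sublinear p" and "\<And>w \<eta>. (w, \<eta>) \<in> K \<Longrightarrow> p w \<le> \<eta>"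
proof -
  have add: "\<And>a b. a \<in> K \<Longrightarrow> b \<in> K \<Longrightarrow> a + b \<in> K"
    and scale: "\<And>c a. c > 0 \<Longrightarrow> a \<in> K \<Longrightarrow> c *\<^sub>R a \<in> K"
    and total: "\<And>w. \<exists>\<eta>. (w, \<eta>) \<in> K"
    and nonneg: "\<And>\<eta>. (0, \<eta>) \<in> K \<Longrightarrow> 0 \<le> \<eta>"
    using assms unfolding dominating_cone_def by blast+
  define p where "p w = Inf {\<eta>. (w, \<eta>) \<in> K}" for w
  have bdd: "bdd_below {\<eta>. (w, \<eta>) \<in> K}" for w
  proof -
    obtain \<eta>' where "(- w, \<eta>') \<in> K" using total by blast
    then have "- \<eta>' \<le> \<eta>" if "(w, \<eta>) \<in> K" for \<eta>
      using add[OF that \<open>(- w, \<eta>') \<in> K\<close>] nonneg by fastforce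
    then show ?thesis by (intro bdd_belowI[of _ "- \<eta>'"]) simp
  qed
  have le: "p w \<le> \<eta>" if "(w, \<eta>) \<in> K" for w \<eta>
    unfolding p_def using that bdd by (auto intro: cInf_lower)
  have ge: "m \<le> p w" if "\<And>\<eta>. (w, \<eta>) \<in> K \<Longrightarrow> m \<le> \<eta>" for w m
    unfolding p_def using that total[of w] by (auto intro!: cInf_greatest)
  have "p (x + y) \<le> p x + p y" for x y
  proof -
    have "p (x + y) - \<eta> \<le> p y" if "(x, \<eta>) \<in> K" for \<eta>
      using add[OF that] le by (intro ge) fastforce
    then have "p (x + y) - p y \<le> p x" by (intro ge) (simp add: algebra_simps)
    then show ?thesis by simp
  qed
  moreover have "p (c *\<^sub>R x) \<le> c * p x" if "c > 0" for c x
  proof -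
    have "p (c *\<^sub>R x) / c \<le> p x"
    proof (rule ge)
      fix \<eta> assume "(x, \<eta>) \<in> K"
      then have "p (c *\<^sub>R x) \<le> c * \<eta>" using scale[OF that] le by fastforce
      then show "p (c *\<^sub>R x) / c \<le> \<eta>" using that by (simp add: field_simps)
    qed
    then show ?thesis using that by (simp add: field_simps)
  qed
  ultimately have "sublinear p" by (simp add: sublinear_def)
  with le show ?thesis using that by blast
qed

text \<open>In the shifted cone, \<open>t = 0\<close> keeps the fibre infimum below
  \<open>p\<close>, and \<open>t = 1\<close> at \<open>- y\<close> pushes it down to
  \<open>- p y\<close>. A linear minorant must therefore agree with \<open>p\<close> at
  \<open>y\<close>.\<close>

lemma dominating_cone_shift:
  assumes p: "sublinear p"
  shows "dominating_cone {(x, \<eta>). \<exists>t\<ge>0. p (x + t *\<^sub>R y) - t * p y \<le> \<eta>}"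
  unfolding dominating_cone_def
proof (intro conjI allI impI ballI; clarsimp)
  fix a \<alpha> b \<beta> t s
  assume "0 \<le> t" "p (a + t *\<^sub>R y) - t * p y \<le> \<alpha>" "0 \<le> s" "p (b + s *\<^sub>R y) - s * p y \<le> \<beta>"
  moreover have "p ((a + b) + (t + s) *\<^sub>R y) \<le> p (a + t *\<^sub>R y) + p (b + s *\<^sub>R y)"
    using sublinear_add[OF p, of "a + t *\<^sub>R y" "b + s *\<^sub>R y"] by (simp add: algebra_simps)
  ultimately show "\<exists>t\<ge>0. p (a + b + t *\<^sub>R y) - t * p y \<le> \<alpha> + \<beta>"
    by (intro exI[of _ "t + s"]) (simp add: algebra_simps)
next
  fix c :: real and a \<alpha> t
  assume c: "0 < c" "0 \<le> t" and le: "p (a + t *\<^sub>R y) - t * p y \<le> \<alpha>"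
  have "p (c *\<^sub>R a + (c * t) *\<^sub>R y) - (c * t) * p y = c * (p (a + t *\<^sub>R y) - t * p y)"
    using sublinear_scale[OF p, of c "a + t *\<^sub>R y"] c by (simp add: algebra_simps)
  also have "\<dots> \<le> c * \<alpha>" using le c by (intro mult_left_mono) auto
  finally show "\<exists>t\<ge>0. p (c *\<^sub>R a + t *\<^sub>R y) - t * p y \<le> c * \<alpha>"
    using c by (intro exI[of _ "c * t"]) simp
next
  fix w
  show "\<exists>\<eta> t. 0 \<le> t \<and> p (w + t *\<^sub>R y) - t * p y \<le> \<eta>"
    by (meson order_refl)
next
  fix \<eta> t assume "0 \<le> t" "p (t *\<^sub>R y) - t * p y \<le> \<eta>"
  then show "0 \<le> \<eta>" using sublinear_scale[OF p] by simp
qed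

text \<open>A minimal sublinear function is linear: shifting it along a vector as in
  \<open>dominating_cone_shift\<close> yields a smaller one unless it is additive.\<close>

lemma sublinear_linear_minorant:
  assumes p0: "sublinear p0"
  obtains L where "linear L" and "\<And>x. L x \<le> p0 x"
proof -
  let ?A = "{p. sublinear p \<and> p \<le> p0}"
  \<comment> \<open>The order is reversed, so that Zorn's lemma delivers a minimal sublinear
    function.\<close>
  let ?P = "\<lambda>p q. q \<le> (p :: 'a \<Rightarrow> real)"
  have "\<exists>L\<in>?A. \<forall>q\<in>?A. ?P L q \<longrightarrow> q = L"
  proof (rule predicate_Zorn)
    show "partial_order_on ?A (relation_of ?P ?A)"
      by (rule partial_order_on_relation_ofI) auto
  next
    fix C assume C: "C \<in> Chains (relation_of ?P ?A)"
    show "\<exists>u\<in>?A. \<forall>a\<in>C. ?P a u"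
    proof (cases "C = {}")
      case True
      then show ?thesis using p0 by auto
    next
      case False
      have CA: "sublinear q \<and> q \<le> p0" if "q \<in> C" for q
        using C that by (auto simp: Chains_def relation_of_def)
      have comp: "q \<le> q' \<or> q' \<le> q" if "q \<in> C" "q' \<in> C" for q q'
        using C that by (auto simp: Chains_def relation_of_def)
      \<comment> \<open>This is the union of the epigraphs of the chain; comparability makes it
        closed under addition. Its sublinear minorant is a lower bound of the chain.\<close>
      have "dominating_cone {(x, \<eta>). \<exists>q\<in>C. q x \<le> \<eta>}"
        unfolding dominating_cone_def
      proof (intro conjI allI impI ballI; clarsimp)
        fix x \<alpha> y \<beta> q q'
        assume h: "q \<in> C" "q x \<le> \<alpha>" "q' \<in> C" "q' y \<le> \<beta>"
        then obtain m where m: "m \<in> C" "m \<le> q" "m \<le> q'" using comp by blast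
        have "m (x + y) \<le> m x + m y" using CA m(1) sublinear_add by blast
        also have "\<dots> \<le> \<alpha> + \<beta>" using m(2,3) h by (meson add_mono le_funD order_trans)
        finally show "\<exists>q\<in>C. q (x + y) \<le> \<alpha> + \<beta>" using m(1) by blast
      next
        fix c :: real and x \<alpha> q
        assume h: "0 < c" "q \<in> C" "q x \<le> \<alpha>"
        then have "q (c *\<^sub>R x) \<le> c * \<alpha>" using CA sublinear_scale[of q c x] by simp
        with h show "\<exists>q\<in>C. q (c *\<^sub>R x) \<le> c * \<alpha>" by blast
      next
        fix w show "\<exists>\<eta>. \<exists>q\<in>C. q w \<le> \<eta>" using False by blast
      next
        fix \<eta> q assume "q \<in> C" "q 0 \<le> \<eta>"
        then show "0 \<le> \<eta>" using CA sublinear_zero by fastforce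
      qed
      then obtain p where p: "sublinear p" "\<And>w \<eta>. (w, \<eta>) \<in> {(x, \<eta>). \<exists>q\<in>C. q x \<le> \<eta>} \<Longrightarrow> p w \<le> \<eta>"
        by (rule sublinear_minorant) blast
      have le: "p \<le> q" if "q \<in> C" for q using p(2) that by (auto simp: le_fun_def)
      moreover have "p \<le> p0" using False CA le by (meson ex_in_conv order_trans)
      ultimately show ?thesis using p(1) by blast
    qed
  qed
  then obtain L where L: "sublinear L" "L \<le> p0"
    and min: "\<And>q. sublinear q \<Longrightarrow> q \<le> L \<Longrightarrow> q = L"
    by (auto dest: order_trans)
  have add: "L (x + y) = L x + L y" for x y
  proof -
    obtain q where q: "sublinear q"
      "\<And>w \<eta>. (w, \<eta>) \<in> {(x, \<eta>). \<exists>t\<ge>0. L (x + t *\<^sub>R y) - t * L y \<le> \<eta>} \<Longrightarrow> q w \<le> \<eta>"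
      using sublinear_minorant[OF dominating_cone_shift[OF L(1), of y]] by blast
    \<comment> \<open>The shift \<open>t = 0\<close> gives \<open>q \<le> L\<close>, hence
      \<open>q = L\<close> by minimality; \<open>t = 1\<close> then yields superadditivity.\<close>
    have "q w \<le> L w" for w by (rule q(2)) (auto intro: exI[of _ 0])
    then have "q = L" using min q(1) by (simp add: le_fun_def)
    moreover have "q x \<le> L (x + y) - L y" by (rule q(2)) (auto intro: exI[of _ 1])
    ultimately show ?thesis using sublinear_add[OF L(1), of x y] by simp
  qed
  have "L (c *\<^sub>R x) = c * L x" for c x
  proof (cases "c \<ge> 0")
    case True
    then show ?thesis using sublinear_scale[OF L(1)] by blast
  next
    case False
    have "L (c *\<^sub>R x) + L ((- c) *\<^sub>R x) = 0"
      using add[of "c *\<^sub>R x" "(- c) *\<^sub>R x"] sublinear_zero[OF L(1)] by simp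
    then show ?thesis using sublinear_scale[OF L(1), of "- c" x] False by simp
  qed
  then have "linear L" using add by (simp add: linear_iff)
  then show ?thesis using that L(2) by (auto simp: le_fun_def)
qed

lemma linear_minorant:
  assumes "dominating_cone K"
  obtains L where "linear L" and "\<And>w \<eta>. (w, \<eta>) \<in> K \<Longrightarrow> L w \<le> \<eta>"
proof -
  obtain p where p: "sublinear p" "\<And>w \<eta>. (w, \<eta>) \<in> K \<Longrightarrow> p w \<le> \<eta>"
    using sublinear_minorant[OF assms] by blast
  obtain L where "linear L" "\<And>x. L x \<le> p x" using sublinear_linear_minorant[OF p(1)] by blast
  then show ?thesis using that p(2) by (meson order_trans)
qed

text \<open>Hahn--Banach for the norm shifted along \<open>x\<close>: the shift \<open>t = 0\<close>
  bounds the functional by the norm, and \<open>t = 1\<close> at \<open>- x\<close> forces its value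
  at \<open>x\<close>.\<close>

lemma norming_functional:
  fixes x :: "'a::real_normed_vector"
  obtains f :: "'a \<Rightarrow>\<^sub>L real" where "norm f \<le> 1" and "blinfun_apply f x = norm x"
proof -
  have "sublinear (norm :: 'a \<Rightarrow> real)" by (simp add: sublinear_def norm_triangle_ineq)
  then obtain L where L: "linear L"
    "\<And>w \<eta>. (w, \<eta>) \<in> {(v, \<eta>). \<exists>t\<ge>0. norm (v + t *\<^sub>R x) - t * norm x \<le> \<eta>} \<Longrightarrow> L w \<le> \<eta>"
    using linear_minorant[OF dominating_cone_shift] by blast
  have le: "L v \<le> norm v" for v by (rule L(2)) (auto intro: exI[of _ 0])
  have "\<bar>L v\<bar> \<le> norm v" for v
    using le[of v] le[of "- v"] linear_neg[OF L(1), of v] by (simp add: abs_le_iff)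
  then have bl: "bounded_linear L"
    using L(1) by (intro bounded_linear_intro[of _ 1]) (auto simp: linear_iff)
  have "L (- x) \<le> - norm x" by (rule L(2)) (auto intro: exI[of _ 1])
  then have "L x = norm x" using le[of x] linear_neg[OF L(1), of x] by simp
  moreover have "norm (Blinfun L) \<le> 1"
    using bl \<open>\<And>v. \<bar>L v\<bar> \<le> norm v\<close> by (intro norm_blinfun_bound) (auto simp: bounded_linear_Blinfun_apply)
  ultimately show ?thesis using that[of "Blinfun L"] bl by (simp add: bounded_linear_Blinfun_apply)
qed

text \<open>Separation after homogenization: an extra real coordinate records a height,
  \<open>1\<close> for the lifted points of \<open>G\<close> and \<open>- 1\<close> for the
  reflected epigraph of \<open>g\<close>. A linear minorant on the enlarged space splits into
  \<open>l\<close> and \<open>c\<close>. Positivity is assumed on the convex hull, so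
  \<open>h\<close> itself may fail to be convex.\<close>

lemma affine_sandwich:
  fixes g h :: "'a::real_vector \<Rightarrow> real"
  assumes ne: "G \<noteq> {}" and g: "convex_on UNIV g"
    and pos: "\<And>a \<eta>. (a, \<eta>) \<in> convex hull ((\<lambda>a. (a, h a)) ` G) \<Longrightarrow> 0 \<le> \<eta> + g a"
  obtains l c where "linear l" and "\<And>a. a \<in> G \<Longrightarrow> l a + c \<le> h a" and "\<And>u. - g u \<le> l u + c"
proof -
  define C where "C = convex hull ((\<lambda>a. (a, h a)) ` G)"
  define C1 where "C1 = (\<lambda>(a, \<eta>). ((a, 1 :: real), \<eta>)) ` C"
  define C2 where "C2 = {((- u, - 1 :: real), \<gamma>) | u \<gamma>. g u \<le> \<gamma>}"
  define K where "K = {a + b | a b. a \<in> cone hull C1 \<and> b \<in> cone hull C2}"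
  have convC: "convex C" by (simp add: C_def)
  have "convex C1"
  proof (rule convexI)
    fix x y u v assume "x \<in> C1" "y \<in> C1" and uv: "0 \<le> u" "0 \<le> v" "u + v = (1::real)"
    then obtain a \<eta> b \<theta> where h: "(a, \<eta>) \<in> C" "x = ((a, 1), \<eta>)" "(b, \<theta>) \<in> C" "y = ((b, 1), \<theta>)"
      by (auto simp: C1_def)
    from convexD[OF convC h(1,3) uv] show "u *\<^sub>R x + v *\<^sub>R y \<in> C1"
      using h uv by (auto simp: C1_def intro!: rev_image_eqI)
  qed
  have "convex C2"
  proof (rule convexI)
    fix x y u v assume "x \<in> C2" "y \<in> C2" and uv: "0 \<le> u" "0 \<le> v" "u + v = (1::real)"
    then obtain a \<eta> b \<theta> where h: "g a \<le> \<eta>" "x = ((- a, - 1), \<eta>)" "g b \<le> \<theta>" "y = ((- b, - 1), \<theta>)"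
      by (auto simp: C2_def)
    have "g (u *\<^sub>R a + v *\<^sub>R b) \<le> u * g a + v * g b"
      using g uv by (auto simp: convex_on_def)
    also have "\<dots> \<le> u * \<eta> + v * \<theta>" using h uv by (intro add_mono mult_left_mono) auto
    finally show "u *\<^sub>R x + v *\<^sub>R y \<in> C2"
      using h uv by (auto simp: C2_def intro!: exI[of _ "u *\<^sub>R a + v *\<^sub>R b"])
  qed
  obtain a0 where a0: "a0 \<in> G" using ne by blast
  have inC: "(a, h a) \<in> C" if "a \<in> G" for a using that by (auto simp: C_def hull_inc)
  have in1: "((a, 1), h a) \<in> C1" if "a \<in> G" for a using inC[OF that] by (auto simp: C1_def)
  have in2: "((- u, - 1), g u) \<in> C2" for u by (auto simp: C2_def)
  have cc: "convex_cone (cone hull C1)" "convex_cone (cone hull C2)"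
    using \<open>convex C1\<close> \<open>convex C2\<close> hull_inc[OF in1[OF a0], where P = cone] hull_inc[OF in2, where P = cone]
      cone_cone_hull[of C1] cone_cone_hull[of C2]
    by (auto simp: convex_cone_def conic_def cone_def convex_cone_hull simp del: cone_hull_empty_iff)
  have z: "0 \<in> cone hull C1" "0 \<in> cone hull C2" using cc by (auto simp: convex_cone_contains_0)
  have KI: "a + b \<in> K" if "a \<in> cone hull C1" "b \<in> cone hull C2" for a b
    unfolding K_def using that by blast
  have K: "dominating_cone K"
    unfolding dominating_cone_def
  proof (intro conjI allI impI ballI)
    fix x y assume "x \<in> K" "y \<in> K"
    then obtain a b a' b' where *: "x = a + b" "y = a' + b'" "a \<in> cone hull C1" "b \<in> cone hull C2"
      "a' \<in> cone hull C1" "b' \<in> cone hull C2" by (auto simp: K_def)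
    have "x + y = (a + a') + (b + b')" using * by simp
    then show "x + y \<in> K" using convex_cone_add[OF cc(1) *(3,5)] convex_cone_add[OF cc(2) *(4,6)]
      unfolding K_def by blast
  next
    fix c :: real and x assume c: "c > 0" and "x \<in> K"
    then obtain a b where *: "x = a + b" "a \<in> cone hull C1" "b \<in> cone hull C2" by (auto simp: K_def)
    then have "c *\<^sub>R x = c *\<^sub>R a + c *\<^sub>R b" by (simp add: scaleR_add_right)
    then show "c *\<^sub>R x \<in> K" 
      using KI[OF convex_cone_scaleR[OF cc(1), of c a] convex_cone_scaleR[OF cc(2), of c b]] c *(2,3)
      by simp
  next
    fix w :: "'a \<times> real"
    obtain v t where w: "w = (v, t)" by fastforce
    \<comment> \<open>With these positive weights the heights add up to \<open>s - r = t\<close>,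
      and \<open>u\<close> is chosen so that
      \<open>s *\<^sub>R a0 - r *\<^sub>R u = v\<close>.\<close>
    define s r where "s = \<bar>t\<bar> + 1" and "r = s - t"
    have s: "s > 0" "r > 0" by (auto simp: s_def r_def)
    define u where "u = (1 / r) *\<^sub>R (s *\<^sub>R a0 - v)"
    have "s *\<^sub>R ((a0, 1), h a0) \<in> cone hull C1" "r *\<^sub>R ((- u, - 1), g u) \<in> cone hull C2"
      using s in1[OF a0] in2[of u]
      by (auto intro!: mem_cone[OF cone_cone_hull] simp: hull_inc simp del: scaleR_Pair)
    moreover have "s *\<^sub>R ((a0, 1 :: real), h a0) + r *\<^sub>R ((- u, - 1), g u) = (w, s * h a0 + r * g u)"
      using s by (simp add: w u_def r_def)
    ultimately show "\<exists>\<eta>. (w, \<eta>) \<in> K" using KI by metis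
  next
    fix \<theta> assume "(0, \<theta>) \<in> K"
    then obtain x y where xy: "x \<in> cone hull C1" "y \<in> cone hull C2" "(0, \<theta>) = x + y"
      by (auto simp: K_def)
    obtain s a \<eta> where s: "s \<ge> 0" "(a, \<eta>) \<in> C" "x = s *\<^sub>R ((a, 1), \<eta>)"
      using xy(1) by (auto simp: cone_hull_expl C1_def)
    obtain r u \<gamma> where r: "r \<ge> 0" "g u \<le> \<gamma>" "y = r *\<^sub>R ((- u, - 1), \<gamma>)"
      using xy(2) unfolding cone_hull_expl C2_def by blast
    \<comment> \<open>Over \<open>0\<close> the heights balance, so the weights agree; unless they
      vanish, both points have the same base and \<open>pos\<close> applies.\<close>
    have eq: "s = r" "s *\<^sub>R a = r *\<^sub>R u" "\<theta> = s * \<eta> + r * \<gamma>"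
      using xy(3) s r by (auto simp: zero_prod_def)
    show "0 \<le> \<theta>"
    proof (cases "s = 0")
      case True
      then show ?thesis using eq by simp
    next
      case False
      then have "a = u" using eq by simp
      then have "0 \<le> \<eta> + \<gamma>" using pos[of a \<eta>] s(2) r(2) by (simp add: C_def)
      then have "0 \<le> s * (\<eta> + \<gamma>)" using s by simp
      then show ?thesis using eq by (simp add: algebra_simps)
    qed
  qed
  obtain L where L: "linear L" "\<And>w \<eta>. (w, \<eta>) \<in> K \<Longrightarrow> L w \<le> \<eta>"
    using linear_minorant[OF K] by blast
  have C_K: "x \<in> K" if "x \<in> C1 \<or> x \<in> C2" for x
    using that KI[of x 0] KI[of 0 x] z hull_inc[of x C1 cone] hull_inc[of x C2 cone] by auto
  define l c where "l v = L (v, 0)" and "c = L (0, 1)" for v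
  have split: "L (v, t) = l v + t * c" for v t
    using linear_add[OF L(1), of "(v, 0)" "(0, t)"] linear_scale[OF L(1), of t "(0, 1)"]
    by (simp add: l_def c_def)
  have "linear l"
    using linear_add[OF L(1), of "(_, 0)" "(_, 0)"] linear_scale[OF L(1), of _ "(_, 0)"]
    by (simp add: linear_iff l_def)
  moreover have "l a + c \<le> h a" if "a \<in> G" for a
    using L(2)[OF C_K] in1[OF that] split[of a 1] by fastforce
  moreover have "- g u \<le> l u + c" for u
  proof -
    have "L (- u, - 1) \<le> g u" using L(2)[OF C_K] in2 by blast
    then show ?thesis using split[of "- u" "- 1"] linear_neg[OF \<open>linear l\<close>, of u] by simp
  qed
  ultimately show ?thesis using that by blast
qed

section \<open>Gauges, Young pairs and duality pairs\<close>

lemma gauge_strict_mono: "gauge_function \<phi> \<Longrightarrow> 0 \<le> r \<Longrightarrow> r < s \<Longrightarrow> \<phi> r < \<phi> s"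
  by (auto simp: gauge_function_def strict_mono_on_def)

lemma gauge_mono: "gauge_function \<phi> \<Longrightarrow> 0 \<le> r \<Longrightarrow> r \<le> s \<Longrightarrow> \<phi> r \<le> \<phi> s"
  using gauge_strict_mono[of \<phi> r s] by (cases "r = s") auto

lemma gauge_zero: "gauge_function \<phi> \<Longrightarrow> \<phi> 0 = 0"
  by (simp add: gauge_function_def)

lemma gauge_nonneg: "gauge_function \<phi> \<Longrightarrow> 0 \<le> r \<Longrightarrow> 0 \<le> \<phi> r"
  using gauge_mono[of \<phi> 0 r] by (simp add: gauge_zero)

lemma gauge_pos: "gauge_function \<phi> \<Longrightarrow> 0 < r \<Longrightarrow> 0 < \<phi> r"
  using gauge_strict_mono[of \<phi> 0 r] by (simp add: gauge_zero)

lemma gauge_surj: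
  assumes "gauge_function \<phi>" and "0 \<le> t"
  shows "\<exists>s\<ge>0. \<phi> s = t"
proof -
  have "\<forall>\<^sub>F s in at_top. t \<le> \<phi> s"
    using assms(1) by (simp add: gauge_function_def filterlim_at_top)
  then obtain b where b: "b \<ge> 0" "t \<le> \<phi> b"
    by (metis eventually_at_top_linorder linorder_le_cases)
  have "continuous_on {0..b} \<phi>"
    using assms(1) continuous_on_subset by (fastforce simp: gauge_function_def)
  then show ?thesis using IVT'[of \<phi> 0 t b] assms b by (auto simp: gauge_zero)
qed

text \<open>A strict subgradient inequality for the primitive of \<open>\<phi>\<close>: the mean
  value theorem supplies a slope at a point strictly between \<open>r\<close> and \<open>s\<close>,
  and \<open>\<phi>\<close> increases strictly. Strictness later decides equality in Young's
  inequality.\<close>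

lemma gauge_primitive:
  assumes \<phi>: "gauge_function \<phi>"
  obtains F where "\<And>r s. 0 \<le> r \<Longrightarrow> 0 \<le> s \<Longrightarrow> r \<noteq> s \<Longrightarrow> F r + \<phi> r * (s - r) < F s"
proof -
  define F where "F s = integral {0..s} \<phi>" for s
  have cont: "continuous_on {0..b} \<phi>" for b
    using \<phi> continuous_on_subset by (fastforce simp: gauge_function_def)
  have mvt: "\<exists>x. r < x \<and> x < s \<and> F s - F r = \<phi> x * (s - r)" if "0 \<le> r" "r < s" for r s
  proof -
    have "(F has_real_derivative \<phi> x) (at x within {0..s})" if "x \<in> {0..s}" for x
      unfolding F_def using integral_has_real_derivative[OF cont that] .
    then have d: "(F has_real_derivative \<phi> x) (at x within {r..s})" if "x \<in> {r..s}" for x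
      using that \<open>0 \<le> r\<close> by (intro DERIV_subset[of F _ x "{0..s}" "{r..s}"]) auto
    then have "continuous_on {r..s} F" by (rule DERIV_continuous_on)
    moreover have "(F has_derivative (*) (\<phi> x)) (at x)" if "r < x" "x < s" for x
    proof -
      have "(F has_real_derivative \<phi> x) (at x within {r<..<s})"
        using d[of x] that by (intro DERIV_subset[of F _ x "{r..s}" "{r<..<s}"]) auto
      then have "(F has_real_derivative \<phi> x) (at x)"
        using that by (simp add: at_within_open[of x "{r<..<s}"])
      then show ?thesis by (simp add: has_field_derivative_def)
    qed
    ultimately obtain x where "r < x" "x < s" "F s - F r = \<phi> x * (s - r)"
      using mvt[OF \<open>r < s\<close>, of F "\<lambda>x. (*) (\<phi> x)"] by blast
    then show ?thesis by blast
  qed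
  have "F r + \<phi> r * (s - r) < F s" if rs: "0 \<le> r" "0 \<le> s" "r \<noteq> s" for r s
  proof (cases "r < s")
    case True
    then obtain x where x: "r < x" "F s - F r = \<phi> x * (s - r)" using mvt rs by blast
    have "\<phi> r * (s - r) < \<phi> x * (s - r)"
      using gauge_strict_mono[OF \<phi> rs(1) x(1)] True by simp
    then show ?thesis using x by simp
  next
    case False
    then have "s < r" using rs by simp
    then obtain x where x: "s < x" "x < r" "F r - F s = \<phi> x * (r - s)" using mvt rs by blast
    have "\<phi> x * (r - s) < \<phi> r * (r - s)"
      using gauge_strict_mono[OF \<phi> _ x(2)] x rs \<open>s < r\<close> by simp
    then show ?thesis using x by (simp add: algebra_simps)
  qed
  then show ?thesis using that by blast
qed

text \<open>\<open>H\<close> is the Legendre conjugate of \<open>F\<close>. The supremum of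
  \<open>s * t - F s\<close> is attained where \<open>\<phi> s = t\<close>, so \<open>H\<close> is
  defined by its value there.\<close>

lemma gauge_young_pair:
  assumes \<phi>: "gauge_function \<phi>"
  obtains F H where "\<And>s t. 0 \<le> s \<Longrightarrow> 0 \<le> t \<Longrightarrow> s * t \<le> F s + H t"
    and "\<And>s t. 0 \<le> s \<Longrightarrow> 0 \<le> t \<Longrightarrow> s * t = F s + H t \<longleftrightarrow> t = \<phi> s"
proof -
  obtain F where F: "\<And>r s. 0 \<le> r \<Longrightarrow> 0 \<le> s \<Longrightarrow> r \<noteq> s \<Longrightarrow> F r + \<phi> r * (s - r) < F s"
    using gauge_primitive[OF \<phi>] by blast
  define \<psi> where "\<psi> t = (SOME s. 0 \<le> s \<and> \<phi> s = t)" for t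
  have \<psi>: "0 \<le> \<psi> t \<and> \<phi> (\<psi> t) = t" if "0 \<le> t" for t
    unfolding \<psi>_def using gauge_surj[OF \<phi> that] by (rule someI2_ex) auto
  define H where "H t = \<psi> t * t - F (\<psi> t)" for t
  have strict: "s * t < F s + H t" if "0 \<le> s" "0 \<le> t" "s \<noteq> \<psi> t" for s t
    using F[of "\<psi> t" s] \<psi>[OF that(2)] that by (auto simp: H_def algebra_simps)
  have eq: "s * t = F s + H t" if "s = \<psi> t" for s t
    using that by (simp add: H_def)
  have inj: "s = \<psi> t \<longleftrightarrow> t = \<phi> s" if "0 \<le> s" "0 \<le> t" for s t
    using \<psi>[OF that(2)] gauge_strict_mono[OF \<phi>, of s "\<psi> t"] gauge_strict_mono[OF \<phi>, of "\<psi> t" s] that(1)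
    by (cases s "\<psi> t" rule: linorder_cases) auto
  show ?thesis
  proof (rule that)
    fix s t :: real assume st: "0 \<le> s" "0 \<le> t"
    show "s * t \<le> F s + H t" using strict[OF st] eq by fastforce
    show "s * t = F s + H t \<longleftrightarrow> t = \<phi> s" using strict[OF st] eq inj[OF st] by fastforce
  qed
qed

lemma convex_on_norm_linear:
  assumes "linear f"
  shows "convex_on UNIV (\<lambda>x. norm (f x))"
  unfolding convex_on_def
proof (intro conjI ballI allI impI)
  fix x y and u v :: real assume "0 \<le> u" "0 \<le> v"
  then show "norm (f (u *\<^sub>R x + v *\<^sub>R y)) \<le> u * norm (f x) + v * norm (f y)"
    using norm_triangle_ineq[of "u *\<^sub>R f x" "v *\<^sub>R f y"]
    by (simp add: linear_add[OF assms] linear_scale[OF assms])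
qed simp

text \<open>On the nonnegative reals \<open>F\<close> is a maximum of affine functions of slope
  \<open>t \<ge> 0\<close>; composed with \<open>N\<close> each of them is convex, and so is their
  maximum. The form of the hypotheses lets \<open>F\<close> and \<open>H\<close> change
  places.\<close>

lemma convex_on_conjugate_comp:
  fixes F H :: "real \<Rightarrow> real"
  assumes N: "convex_on UNIV N" "\<And>x. 0 \<le> N x"
    and le: "\<And>s t. 0 \<le> s \<Longrightarrow> 0 \<le> t \<Longrightarrow> s * t \<le> F s + H t"
    and attained: "\<And>s. 0 \<le> s \<Longrightarrow> \<exists>t\<ge>0. s * t = F s + H t"
  shows "convex_on UNIV (\<lambda>x. F (N x))"
  unfolding convex_on_def
proof (intro conjI ballI allI impI)
  fix x y and u v :: real
  assume uv: "0 \<le> u" "0 \<le> v" "u + v = 1"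
  let ?s = "N (u *\<^sub>R x + v *\<^sub>R y)"
  obtain t where t: "0 \<le> t" "?s * t = F ?s + H t" using attained[OF N(2)] by blast
  have v: "v = 1 - u" using uv by simp
  have "?s \<le> u * N x + v * N y"
    using N(1) uv by (simp add: convex_on_def)
  then have "?s * t \<le> (u * N x + v * N y) * t"
    using t(1) by (rule mult_right_mono)
  then have "F ?s \<le> (u * N x + v * N y) * t - H t" using t(2) by simp
  also have "\<dots> = u * (N x * t - H t) + v * (N y * t - H t)" by (simp add: v algebra_simps)
  also have "\<dots> \<le> u * F (N x) + v * F (N y)"
    using le[OF N(2) t(1), of x] le[OF N(2) t(1), of y] uv by (intro add_mono mult_left_mono) auto
  finally show "F ?s \<le> u * F (N x) + v * F (N y)" .
qed simp

text \<open>The relation whose unique solution \<open>duality_map\<close> selects; it makes sense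
  before uniqueness is known.\<close>

definition duality_pair ::
  "(real \<Rightarrow> real) \<Rightarrow> 'a::real_normed_vector \<Rightarrow> ('a \<Rightarrow>\<^sub>L real) \<Rightarrow> bool" where
  "duality_pair \<phi> x f \<longleftrightarrow> blinfun_apply f x = \<phi> (norm x) * norm x \<and> norm f = \<phi> (norm x)"

lemma blinfun_abs_le:
  fixes f :: "'a::real_normed_vector \<Rightarrow>\<^sub>L real"
  shows "\<bar>blinfun_apply f x\<bar> \<le> norm f * norm x"
  using norm_blinfun[of f x] by simp

lemma blinfun_le:
  fixes f :: "'a::real_normed_vector \<Rightarrow>\<^sub>L real"
  shows "blinfun_apply f x \<le> norm f * norm x"
  using blinfun_abs_le[of f x] by simp

lemma gauge_product_nonneg:
  assumes "gauge_function \<phi>" and "0 \<le> r" and "0 \<le> s"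
  shows "0 \<le> (\<phi> r - \<phi> s) * (r - s)"
  using gauge_mono[OF assms(1), of r s] gauge_mono[OF assms(1), of s r] assms(2,3)
  by (cases "s \<le> r") (auto intro: mult_nonneg_nonneg mult_nonpos_nonpos)

text \<open>Expand the pairing and bound the two mixed terms by products of norms.\<close>

lemma duality_pair_monotone:
  assumes "duality_pair \<phi> x f" and "duality_pair \<phi> y g"
  shows "(\<phi> (norm x) - \<phi> (norm y)) * (norm x - norm y) \<le> blinfun_apply (f - g) (x - y)"
  using assms blinfun_le[of f y] blinfun_le[of g x]
  by (simp add: duality_pair_def blinfun.diff_left blinfun.diff_right algebra_simps)

lemma duality_pair_exists:
  fixes x :: "'a::real_normed_vector"
  assumes \<phi>: "gauge_function \<phi>"
  shows "\<exists>f. duality_pair \<phi> x f"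
proof -
  obtain f :: "'a \<Rightarrow>\<^sub>L real" where f: "norm f \<le> 1" "blinfun_apply f x = norm x"
    by (rule norming_functional)
  have "norm f = 1" if "x \<noteq> 0"
  proof -
    have "1 * norm x \<le> norm f * norm x" using blinfun_le[of f x] f by simp
    then show ?thesis using f that by simp
  qed
  then have "duality_pair \<phi> x (\<phi> (norm x) *\<^sub>R f)"
    using f \<phi> by (cases "x = 0") (auto simp: duality_pair_def gauge_zero gauge_nonneg blinfun.scaleR_left)
  then show ?thesis by blast
qed

lemma duality_pair_uminus: "duality_pair \<phi> (- x) (- f) \<longleftrightarrow> duality_pair \<phi> x f"
  by (simp add: duality_pair_def blinfun.minus_left blinfun.minus_right)

section \<open>Solvability of the resolvent inclusion\<close>

text \<open>The convex hull of the graph, lifted by the duality product, stays above the product itself: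
  the lifted graph lies in the half-spaces cut out by the Fitzpatrick function, and testing a hull
  point against the half-space it defines doubles the product.\<close>

lemma monotone_hull_above_product:
  fixes A :: "'a::real_normed_vector \<Rightarrow> ('a \<Rightarrow>\<^sub>L real) set"
  assumes "monotone_op A"
    and "(a, \<eta>) \<in> convex hull ((\<lambda>a. (a, blinfun_apply (snd a) (fst a))) ` {(y, v). v \<in> A y})"
  shows "blinfun_apply (snd a) (fst a) \<le> \<eta>"
proof -
  let ?G = "{(y, v). v \<in> A y}"
  let ?C = "(\<lambda>a. (a, blinfun_apply (snd a) (fst a))) ` ?G"
  \<comment> \<open>A half-space whose membership is symmetric:
    \<open>(a, \<eta>) \<in> S b \<theta>\<close> iff
    \<open>(b, \<theta>) \<in> S a \<eta>\<close>.\<close>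
  define S where "S b \<theta> = {(a, \<eta>). blinfun_apply (snd b) (fst a) + blinfun_apply (snd a) (fst b) - \<theta> \<le> \<eta>}"
    for b :: "'a \<times> ('a \<Rightarrow>\<^sub>L real)" and \<theta> :: real
  have conv: "convex (S b \<theta>)" for b \<theta>
  proof (rule convexI)
    fix x y u v assume h: "x \<in> S b \<theta>" "y \<in> S b \<theta>" "0 \<le> u" "0 \<le> v" "u + v = (1::real)"
    obtain a1 f1 \<eta>1 a2 f2 \<eta>2 where xy: "x = ((a1, f1), \<eta>1)" "y = ((a2, f2), \<eta>2)"
      by (metis surj_pair)
    have "u * (blinfun_apply (snd b) a1 + blinfun_apply f1 (fst b) - \<theta>) \<le> u * \<eta>1"
      and "v * (blinfun_apply (snd b) a2 + blinfun_apply f2 (fst b) - \<theta>) \<le> v * \<eta>2"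
      using h xy by (auto simp: S_def intro!: mult_left_mono)
    moreover have "u * \<theta> + v * \<theta> = \<theta>" using h by (metis distrib_right mult_1)
    ultimately have "blinfun_apply (snd b) (u *\<^sub>R a1 + v *\<^sub>R a2)
      + blinfun_apply (u *\<^sub>R f1 + v *\<^sub>R f2) (fst b) - \<theta> \<le> u * \<eta>1 + v * \<eta>2"
      by (simp only: blinfun.add_left blinfun.add_right blinfun.scaleR_left
          blinfun.scaleR_right real_scaleR_def distrib_left right_diff_distrib)
    then show "u *\<^sub>R x + v *\<^sub>R y \<in> S b \<theta>" by (simp add: S_def xy)
  qed
  have CS: "?C \<subseteq> S b (blinfun_apply (snd b) (fst b))" if b: "b \<in> ?G" for b
  proof clarify
    fix y v assume "v \<in> A y"
    then have "0 \<le> blinfun_apply (v - snd b) (y - fst b)"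
      using assms(1) b unfolding monotone_op_def by auto
    then show "((y, v), blinfun_apply (snd (y, v)) (fst (y, v))) \<in> S b (blinfun_apply (snd b) (fst b))"
      by (simp add: S_def blinfun.diff_left blinfun.diff_right)
  qed
  have hull: "(a, \<eta>) \<in> S b \<theta>" if "?C \<subseteq> S b \<theta>" for b \<theta>
    using hull_minimal[OF that, of convex] conv assms(2) by blast
  \<comment> \<open>The hull point lies in the half-space of every graph point; by symmetry the
    lifted graph lies in the half-space of the hull point, and so does its hull.\<close>
  have "?C \<subseteq> S a \<eta>"
  proof clarify
    fix y v assume "v \<in> A y"
    then have "(a, \<eta>) \<in> S (y, v) (blinfun_apply v y)" using hull[OF CS[of "(y, v)"]] by simp
    then show "((y, v), blinfun_apply (snd (y, v)) (fst (y, v))) \<in> S a \<eta>"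
      by (simp add: S_def)
  qed
  then have "(a, \<eta>) \<in> S a \<eta>" by (rule hull)
  then show ?thesis by (simp add: S_def)
qed

text \<open>By reflexivity the functional on the dual that norms \<open>f\<close> is evaluation at a
  point, so \<open>f\<close> attains its norm there; \<open>s\<close> rescales that point.\<close>

lemma reflexive_norming_vector:
  fixes f :: "'a::real_normed_vector \<Rightarrow>\<^sub>L real"
  assumes "reflexive_space TYPE('a)" and "0 \<le> s"
  obtains x where "norm x \<le> s" and "blinfun_apply f x = s * norm f"
proof -
  obtain F :: "('a \<Rightarrow>\<^sub>L real) \<Rightarrow>\<^sub>L real" where F: "norm F \<le> 1" "blinfun_apply F f = norm f"
    by (rule norming_functional)
  obtain x where x: "\<And>g. blinfun_apply F g = blinfun_apply g x"
    using assms(1) unfolding reflexive_space_def by blast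
  \<comment> \<open>\<open>reflexive_space\<close> does not mention the norm of the representing
    point; a functional norming \<open>x\<close> recovers it from
    \<open>norm F \<le> 1\<close>.\<close>
  obtain g :: "'a \<Rightarrow>\<^sub>L real" where g: "norm g \<le> 1" "blinfun_apply g x = norm x"
    by (rule norming_functional)
  have "norm x \<le> norm F * norm g" using blinfun_le[of F g] g x by simp
  also have "\<dots> \<le> 1" using F g by (simp add: mult_le_one)
  finally have "norm (s *\<^sub>R x) \<le> s" using assms(2) by (simp add: mult_left_le)
  moreover have "blinfun_apply f (s *\<^sub>R x) = s * norm f"
    using F x by (simp add: blinfun.scaleR_right)
  ultimately show ?thesis using that by blast
qed

text \<open>The resolvent inclusion for the point \<open>0\<close> and parameter \<open>1\<close>;
  scaling and translation reduce the general case to it.\<close>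

theorem maximal_monotone_plus_duality_surjective:
  fixes A :: "'a::real_normed_vector \<Rightarrow> ('a \<Rightarrow>\<^sub>L real) set"
  assumes refl: "reflexive_space TYPE('a)" and max: "maximal_monotone A"
    and \<phi>: "gauge_function \<phi>"
  shows "\<exists>w. \<exists>f\<in>A w. duality_pair \<phi> w (- f)"
proof -
  obtain F H where young: "\<And>s t. 0 \<le> s \<Longrightarrow> 0 \<le> t \<Longrightarrow> s * t \<le> F s + H t"
    and young_eq: "\<And>s t. 0 \<le> s \<Longrightarrow> 0 \<le> t \<Longrightarrow> s * t = F s + H t \<longleftrightarrow> t = \<phi> s"
    using gauge_young_pair[OF \<phi>] by blast
  define G where "G = {(y, v). v \<in> A y}"
  define g where "g a = F (norm (fst a)) + H (norm (snd a))" for a :: "'a \<times> ('a \<Rightarrow>\<^sub>L real)"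
  have prod_le: "- blinfun_apply f x \<le> F (norm x) + H (norm f)" for x :: 'a and f
    using blinfun_abs_le[of f x] young[of "norm x" "norm f"] by (simp add: mult.commute)
  have "convex_on UNIV (\<lambda>a :: 'a \<times> ('a \<Rightarrow>\<^sub>L real). F (norm (fst a)))"
  proof (rule convex_on_conjugate_comp[OF convex_on_norm_linear norm_ge_zero young])
    show "\<exists>t\<ge>0. s * t = F s + H t" if "0 \<le> s" for s
      using young_eq[OF that] gauge_nonneg[OF \<phi> that] by blast
  qed (auto simp: linear_fst)
  moreover have "convex_on UNIV (\<lambda>a :: 'a \<times> ('a \<Rightarrow>\<^sub>L real). H (norm (snd a)))"
  proof (rule convex_on_conjugate_comp[OF convex_on_norm_linear norm_ge_zero])
    show "s * t \<le> H s + F t" if "0 \<le> s" "0 \<le> t" for s t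
      using young[OF that(2,1)] by (simp add: algebra_simps)
    show "\<exists>t\<ge>0. s * t = H s + F t" if "0 \<le> s" for s
      using gauge_surj[OF \<phi> that] young_eq[OF _ that] by (metis add.commute mult.commute)
  qed (auto simp: linear_snd)
  ultimately have convg: "convex_on UNIV g"
    unfolding g_def by (rule convex_on_add)
  have "G \<noteq> {}"
  proof
    assume "G = {}"
    then have "0 \<in> A 0" using max by (auto simp: maximal_monotone_def G_def)
    with \<open>G = {}\<close> show False by (auto simp: G_def)
  qed
  moreover have "0 \<le> \<eta> + g a"
    if "(a, \<eta>) \<in> convex hull ((\<lambda>a. (a, blinfun_apply (snd a) (fst a))) ` G)" for a \<eta>
  proof -
    have "monotone_op A" using max by (simp add: maximal_monotone_def)
    then have "blinfun_apply (snd a) (fst a) \<le> \<eta>"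
      using monotone_hull_above_product that unfolding G_def by blast
    then show ?thesis using prod_le[of "snd a" "fst a"] by (simp add: g_def)
  qed
  ultimately obtain l c where l: "linear l"
    and l_le: "\<And>a. a \<in> G \<Longrightarrow> l a + c \<le> blinfun_apply (snd a) (fst a)"
    and l_ge: "\<And>a. - g a \<le> l a + c"
    using affine_sandwich[OF _ convg, of G "\<lambda>a. blinfun_apply (snd a) (fst a)"] by blast
  \<comment> \<open>\<open>g\<close> is even, so its lower bound at \<open>b\<close> and
    \<open>- b\<close> bounds \<open>l\<close> on both sides. At unit vectors of the two axes
    \<open>g\<close> is \<open>F 1 + H 0\<close> or \<open>F 0 + H 1\<close>, and the constant
    dominates both.\<close>
  have bdd: "\<bar>l a\<bar> \<le> (F 1 + H 1 + \<bar>F 0\<bar> + \<bar>H 0\<bar> + c) * norm a" if "fst a = 0 \<or> snd a = 0" for a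
  proof (cases "a = 0")
    case True
    then show ?thesis using linear_0[OF l] by simp
  next
    case False
    define b where "b = (1 / norm a) *\<^sub>R a"
    have b: "fst b = 0 \<and> norm (snd b) = 1 \<or> snd b = 0 \<and> norm (fst b) = 1"
      using that False by (auto simp: b_def norm_prod_def prod_eq_iff)
    have "0 \<le> F 1 + H 0" "0 \<le> F 0 + H 1" "0 \<le> F 0 + H 0"
      using young[of 1 0] young[of 0 1] young[of 0 0] by auto
    then have gb: "g b \<le> F 1 + H 1 + \<bar>F 0\<bar> + \<bar>H 0\<bar>" "g (- b) \<le> F 1 + H 1 + \<bar>F 0\<bar> + \<bar>H 0\<bar>"
      using b by (auto simp: g_def)
    have "\<bar>l b\<bar> \<le> F 1 + H 1 + \<bar>F 0\<bar> + \<bar>H 0\<bar> + c"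
      using gb l_ge[of b] l_ge[of "- b"] linear_neg[OF l, of b] by (simp add: abs_le_iff)
    moreover have "l a = norm a * l b" using False by (simp add: b_def linear_scale[OF l])
    ultimately show ?thesis by (simp add: abs_mult mult.commute[of _ "norm a"] mult_left_mono)
  qed
  let ?M = "F 1 + H 1 + \<bar>F 0\<bar> + \<bar>H 0\<bar> + c"
  have "bounded_linear (\<lambda>x. l (x, 0))"
    using linear_add[OF l, of "(_, 0)" "(_, 0)"] linear_scale[OF l, of _ "(_, 0)"] bdd[of "(_, 0)"]
    by (intro bounded_linear_intro[of _ ?M]) (auto simp: norm_Pair mult.commute)
  then obtain w' :: "'a \<Rightarrow>\<^sub>L real" where w': "\<And>x. l (x, 0) = blinfun_apply w' x"
    by (metis bounded_linear_Blinfun_apply)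
  have "bounded_linear (\<lambda>f. l (0, f))"
    using linear_add[OF l, of "(0, _)" "(0, _)"] linear_scale[OF l, of _ "(0, _)"] bdd[of "(0, _)"]
    by (intro bounded_linear_intro[of _ ?M]) (auto simp: norm_Pair mult.commute)
  then obtain W :: "('a \<Rightarrow>\<^sub>L real) \<Rightarrow>\<^sub>L real" where "\<And>f. l (0, f) = blinfun_apply W f"
    by (metis bounded_linear_Blinfun_apply)
  then obtain w where w: "\<And>f. l (0, f) = blinfun_apply f w"
    using refl unfolding reflexive_space_def by metis
  have l_eq: "l (x, f) = blinfun_apply w' x + blinfun_apply f w" for x f
    using linear_add[OF l, of "(x, 0)" "(0, f)"] w w' by simp
  \<comment> \<open>\<open>c\<close> dominates the conjugate of \<open>g\<close>: test the lower
    bound at \<open>(- x, - j)\<close>, where \<open>j\<close> is dual to \<open>w\<close>,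
    \<open>w'\<close> attains its norm along \<open>x\<close>, and
    \<open>\<phi> (norm x) = norm w'\<close>. Both instances of Young's inequality are then
    equalities.\<close>
  have c_ge: "F (norm w) + H (norm w') \<le> c"
  proof -
    obtain j where j: "duality_pair \<phi> w j" using duality_pair_exists[OF \<phi>] by blast
    obtain s where s: "s \<ge> 0" "\<phi> s = norm w'" using gauge_surj[OF \<phi>, of "norm w'"] by auto
    obtain x where x: "norm x \<le> s" "blinfun_apply w' x = s * norm w'"
      using reflexive_norming_vector[OF refl s(1)] by blast
    have "s * norm w' \<le> norm w' * norm x" using blinfun_le[of w' x] x by simp
    moreover have "norm w' > 0" if "s \<noteq> 0" using gauge_pos[OF \<phi>, of s] s that by simp
    ultimately have nx: "norm x = s"
      using x(1) s(1) by (cases "s = 0") (auto simp: mult.commute)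
    have "F s + H (norm w') = s * norm w'" "F (norm w) + H (norm j) = norm w * norm j"
      using young_eq[of s "norm w'"] young_eq[of "norm w" "norm j"] s j by (auto simp: duality_pair_def)
    moreover have "- g (- x, - j) \<le> l (- x, - j) + c" by (rule l_ge)
    ultimately show ?thesis
      using nx x j by (simp add: g_def l_eq blinfun.minus_left blinfun.minus_right duality_pair_def mult.commute)
  qed
  have ge: "F (norm w) + H (norm w') + blinfun_apply w' w \<le> blinfun_apply (v - w') (y - w)"
    if "v \<in> A y" for y v
    using l_le[of "(y, v)"] that c_ge
    by (simp add: G_def l_eq blinfun.diff_left blinfun.diff_right)
  have "0 \<le> blinfun_apply (w' - v) (w - y)" if "v \<in> A y" for y v
    using ge[OF that] prod_le[of w' w] by (simp add: blinfun.diff_left blinfun.diff_right)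
  then have mem: "w' \<in> A w" using max unfolding maximal_monotone_def by blast
  \<comment> \<open>At the point itself the right side of \<open>ge\<close> vanishes, which forces
    equality in \<open>prod_le\<close>.\<close>
  have eq: "F (norm w) + H (norm w') = - blinfun_apply w' w"
    using ge[OF mem] prod_le[of w' w] by simp
  also have "\<dots> \<le> norm w * norm w'" using blinfun_abs_le[of w' w] by (simp add: mult.commute)
  finally have "norm w * norm w' = F (norm w) + H (norm w')"
    using young[of "norm w" "norm w'"] by simp
  moreover from this have "norm w' = \<phi> (norm w)" using young_eq by simp
  ultimately have "duality_pair \<phi> w (- w')"
    using eq by (simp add: duality_pair_def blinfun.minus_left mult.commute)
  with mem show ?thesis by blast
qed


section \<open>Convergence in locally uniformly convex spaces\<close>

text \<open>A Radon--Riesz property in which one functional attaining its bound \<open>M\<close> at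
  \<open>z\<close> replaces weak convergence: after normalization \<open>f (en n + e)\<close> tends
  to \<open>2 * M\<close>, so \<open>norm (en n + e)\<close> tends to \<open>2\<close>. Taking
  \<open>f\<close> merely linear admits functionals as well as evaluations on the dual.\<close>

lemma locally_uniformly_convex_tendsto:
  fixes z :: "'b::real_normed_vector"
  assumes luc: "locally_uniformly_convex TYPE('b)"
    and f: "linear f" "\<And>v. f v \<le> M * norm v" "f z = M * norm z" "M > 0"
    and nlim: "(\<lambda>n. norm (zn n)) \<longlonglongrightarrow> norm z"
    and flim: "(\<lambda>n. f (zn n)) \<longlonglongrightarrow> f z"
  shows "zn \<longlonglongrightarrow> z"
proof (cases "z = 0")
  case True
  then show ?thesis using nlim by (simp add: tendsto_norm_zero_iff)
next
  case False
  define e where "e = (1 / norm z) *\<^sub>R z"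
  define en where "en n = (1 / norm (zn n)) *\<^sub>R zn n" for n
  have ne: "\<forall>\<^sub>F n in sequentially. norm (zn n) > 0"
    using order_tendstoD(1)[OF nlim, of 0] False by simp
  have norm_e: "norm e = 1" using False by (simp add: e_def)
  have "(\<lambda>n. f (zn n) / norm (zn n) + f z / norm z) \<longlonglongrightarrow> f z / norm z + f z / norm z"
    using nlim flim False by (intro tendsto_add tendsto_divide tendsto_const) auto
  also have "f z / norm z + f z / norm z = 2 * M" using f(3) False by simp
  also have "(\<lambda>n. f (zn n) / norm (zn n) + f z / norm z) = (\<lambda>n. f (en n + e))"
    by (simp add: en_def e_def linear_add[OF f(1)] linear_scale[OF f(1)])
  finally have lim2: "(\<lambda>n. f (en n + e)) \<longlonglongrightarrow> 2 * M" .
  have "en \<longlonglongrightarrow> e"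
  proof (rule tendstoI)
    fix r :: real assume "r > 0"
    \<comment> \<open>The radius is cut to \<open>min r 2\<close> because the modulus of convexity
      is given only up to \<open>2\<close>.\<close>
    then obtain d where d: "d > 0"
      "\<And>x. norm x = 1 \<Longrightarrow> norm (x - e) \<ge> min r 2 \<Longrightarrow> norm (x + e) \<le> 2 * (1 - d)"
      using luc norm_e unfolding locally_uniformly_convex_def
      by (metis min.cobounded2 min_less_iff_conj zero_less_numeral)
    have "\<forall>\<^sub>F n in sequentially. 2 * M * (1 - d) < f (en n + e)"
      using d(1) f(4) by (intro order_tendstoD(1)[OF lim2]) (simp add: algebra_simps)
    with ne show "\<forall>\<^sub>F n in sequentially. dist (en n) e < r"
    proof eventually_elim
      case (elim n)
      have "M * (2 * (1 - d)) < M * norm (en n + e)"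
        using elim(2) f(2)[of "en n + e"] by (simp add: algebra_simps)
      then have "\<not> norm (en n + e) \<le> 2 * (1 - d)" using f(4) by simp
      moreover have "norm (en n) = 1" using elim(1) by (simp add: en_def)
      ultimately have "\<not> norm (en n - e) \<ge> min r 2" using d(2) by blast
      then show ?case by (simp add: dist_norm)
    qed
  qed
  then have "(\<lambda>n. norm (zn n) *\<^sub>R en n) \<longlonglongrightarrow> norm z *\<^sub>R e"
    by (rule tendsto_scaleR[OF nlim])
  moreover have "\<forall>\<^sub>F n in sequentially. norm (zn n) *\<^sub>R en n = zn n"
    using ne by eventually_elim (simp add: en_def)
  ultimately show ?thesis
    using False by (simp add: e_def tendsto_cong)
qed

text \<open>Away from the origin the constant sequence \<open>f'\<close> has the norm of
  \<open>f\<close> and its value at \<open>x\<close>, so the convergence criterion in the dual makes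
  it tend to \<open>f\<close>.\<close>

lemma duality_pair_unique:
  fixes x :: "'a::real_normed_vector"
  assumes luc: "locally_uniformly_convex TYPE('a \<Rightarrow>\<^sub>L real)"
    and "gauge_function \<phi>" and f: "duality_pair \<phi> x f" and f': "duality_pair \<phi> x f'"
  shows "f' = f"
proof (cases "x = 0")
  case True
  then show ?thesis using assms by (simp add: duality_pair_def gauge_zero)
next
  case False
  have "(\<lambda>n::nat. f') \<longlonglongrightarrow> f"
  proof (rule locally_uniformly_convex_tendsto[OF luc, where f = "\<lambda>g. blinfun_apply g x" and M = "norm x"])
    show "linear (\<lambda>g. blinfun_apply g x)"
      by (simp add: linear_iff blinfun.add_left blinfun.scaleR_left)
    show "blinfun_apply g x \<le> norm x * norm g" for g
      using blinfun_le[of g x] by (simp add: mult.commute)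
  qed (use f f' False in \<open>auto simp: duality_pair_def\<close>)
  then show ?thesis by (simp add: LIMSEQ_const_iff)
qed

lemma duality_pair_duality_map:
  fixes x :: "'a::real_normed_vector"
  assumes "locally_uniformly_convex TYPE('a \<Rightarrow>\<^sub>L real)" and "gauge_function \<phi>"
  shows "duality_pair \<phi> x (duality_map \<phi> x)"
proof -
  have "\<exists>!f. duality_pair \<phi> x f"
    using duality_pair_exists[OF assms(2), of x] duality_pair_unique[OF assms] by blast
  then show ?thesis
    unfolding duality_map_def duality_pair_def by (rule theI')
qed

text \<open>The two factors have the same sign, and outside an \<open>e\<close>-neighbourhood of
  \<open>r\<close> both are bounded away from zero.\<close>

lemma gauge_tendsto_imp_tendsto:
  assumes \<phi>: "gauge_function \<phi>" and r: "0 \<le> r" "\<And>n. 0 \<le> rn n"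
    and lim: "(\<lambda>n. (\<phi> (rn n) - \<phi> r) * (rn n - r)) \<longlonglongrightarrow> 0"
  shows "rn \<longlonglongrightarrow> r"
proof (rule tendstoI)
  fix e :: real assume e: "e > 0"
  \<comment> \<open>If \<open>r - e < 0\<close>, no \<open>rn n\<close> lies below
    \<open>r - e\<close>, and the value \<open>1\<close> is a placeholder.\<close>
  define d where "d = min (\<phi> (r + e) - \<phi> r) (if r - e \<ge> 0 then \<phi> r - \<phi> (r - e) else 1)"
  have d: "d > 0" using gauge_strict_mono[OF \<phi>] r e by (simp add: d_def)
  have "\<forall>\<^sub>F n in sequentially. (\<phi> (rn n) - \<phi> r) * (rn n - r) < d * e"
    using d e by (intro order_tendstoD(2)[OF lim]) simp
  then show "\<forall>\<^sub>F n in sequentially. dist (rn n) r < e"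
  proof eventually_elim
    case (elim n)
    show ?case
    proof (rule ccontr)
      assume "\<not> dist (rn n) r < e"
      then consider "rn n \<ge> r + e" | "rn n \<le> r - e" by (auto simp: dist_real_def abs_if split: if_splits)
      then have "d * e \<le> (\<phi> (rn n) - \<phi> r) * (rn n - r)"
      proof cases
        case 1
        then have "d \<le> \<phi> (rn n) - \<phi> r" using gauge_mono[OF \<phi>, of "r + e" "rn n"] r e by (simp add: d_def)
        with 1 d e show ?thesis by (intro mult_mono) auto
      next
        case 2
        then have "d \<le> \<phi> r - \<phi> (rn n)"
          using gauge_mono[OF \<phi>, of "rn n" "r - e"] r(2)[of n] by (auto simp: d_def)
        with 2 d e have "d * e \<le> (\<phi> r - \<phi> (rn n)) * (r - rn n)" by (intro mult_mono) auto
        then show ?thesis by (simp add: algebra_simps)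
      qed
      with elim show False by simp
    qed
  qed
qed

lemma duality_pair_tendsto:
  fixes z :: "'a::real_normed_vector"
  assumes luc: "locally_uniformly_convex TYPE('a)" "locally_uniformly_convex TYPE('a \<Rightarrow>\<^sub>L real)"
    and \<phi>: "gauge_function \<phi>"
    and pn: "\<And>n. duality_pair \<phi> (zn n) (jn n)" and p: "duality_pair \<phi> z j"
    and lim: "(\<lambda>n. blinfun_apply (jn n - j) (zn n - z)) \<longlonglongrightarrow> 0"
  shows "zn \<longlonglongrightarrow> z \<and> jn \<longlonglongrightarrow> j"
proof -
  let ?r = "norm z" and ?rn = "\<lambda>n. norm (zn n)"
  have dn: "blinfun_apply (jn n) (zn n) = \<phi> (?rn n) * ?rn n" "norm (jn n) = \<phi> (?rn n)" for n
    using pn by (auto simp: duality_pair_def)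
  have d: "blinfun_apply j z = \<phi> ?r * ?r" "norm j = \<phi> ?r"
    using p by (auto simp: duality_pair_def)
  \<comment> \<open>\<open>A\<close> compares the norms; \<open>B\<close> and \<open>C\<close> are
    the defects in the norm estimates of \<open>jn n\<close> at \<open>z\<close> and of
    \<open>j\<close> at \<open>zn n\<close>.\<close>
  define A where "A n = (\<phi> (?rn n) - \<phi> ?r) * (?rn n - ?r)" for n
  define B where "B n = \<phi> (?rn n) * ?r - blinfun_apply (jn n) z" for n
  define C where "C n = \<phi> ?r * ?rn n - blinfun_apply j (zn n)" for n
  have split: "blinfun_apply (jn n - j) (zn n - z) = A n + B n + C n" for n
    by (simp add: A_def B_def C_def blinfun.diff_left blinfun.diff_right dn d algebra_simps)
  have nonneg: "0 \<le> A n" "0 \<le> B n" "0 \<le> C n" for n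
  proof -
    show "0 \<le> A n" using gauge_product_nonneg[OF \<phi>] by (simp add: A_def)
    show "0 \<le> B n" "0 \<le> C n"
      using blinfun_le[of "jn n" z] blinfun_le[of j "zn n"] by (auto simp: B_def C_def dn d)
  qed
  have lim0: "X \<longlonglongrightarrow> 0" if "\<And>n. 0 \<le> X n" "\<And>n. X n \<le> A n + B n + C n" for X
    using that lim by (intro tendsto_sandwich[of "\<lambda>n. 0" X]) (auto simp: split)
  have A: "A \<longlonglongrightarrow> 0" and B: "B \<longlonglongrightarrow> 0" and C: "C \<longlonglongrightarrow> 0"
    by (rule lim0, use nonneg in simp_all)+
  have r: "?rn \<longlonglongrightarrow> ?r"
    by (rule gauge_tendsto_imp_tendsto[OF \<phi> norm_ge_zero norm_ge_zero A[unfolded A_def]])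
  have "(\<lambda>n. \<phi> (?rn n)) \<longlonglongrightarrow> \<phi> ?r"
    using \<phi> by (intro continuous_on_tendsto_compose[OF _ r, of "{0..}"]) (simp_all add: gauge_function_def)
  then have nj: "(\<lambda>n. norm (jn n)) \<longlonglongrightarrow> norm j" by (simp add: dn d)
  show ?thesis
  \<comment> \<open>The criterion demands a bound \<open>M > 0\<close>, which fails at the origin;
    there convergence of the norms is enough.\<close>
  proof (cases "z = 0")
    case True
    then have "j = 0" using d gauge_zero[OF \<phi>] by simp
    then show ?thesis using True r nj by (simp only: norm_zero tendsto_norm_zero_iff simp_thms)
  next
    case False
    have "(\<lambda>n. \<phi> ?r * ?rn n - C n) \<longlonglongrightarrow> \<phi> ?r * ?r - 0"
      by (intro tendsto_diff tendsto_mult tendsto_const C r)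
    then have "(\<lambda>n. blinfun_apply j (zn n)) \<longlonglongrightarrow> blinfun_apply j z"
      by (simp add: C_def d)
    moreover have "(\<lambda>n. norm (jn n) * ?r - B n) \<longlonglongrightarrow> norm j * ?r - 0"
      by (intro tendsto_diff tendsto_mult tendsto_const B nj)
    then have "(\<lambda>n. blinfun_apply (jn n) z) \<longlonglongrightarrow> blinfun_apply j z"
      by (simp add: B_def d dn)
    ultimately show ?thesis
    proof (intro conjI)
      assume 1: "(\<lambda>n. blinfun_apply j (zn n)) \<longlonglongrightarrow> blinfun_apply j z"
        and 2: "(\<lambda>n. blinfun_apply (jn n) z) \<longlonglongrightarrow> blinfun_apply j z"
      show "zn \<longlonglongrightarrow> z"
        by (rule locally_uniformly_convex_tendsto[OF luc(1), where f = "blinfun_apply j" and M = "norm j"])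
          (use 1 r False gauge_pos[OF \<phi>] d blinfun_le[of j] in
            \<open>auto simp: linear_iff blinfun.add_right blinfun.scaleR_right\<close>)
      show "jn \<longlonglongrightarrow> j"
        by (rule locally_uniformly_convex_tendsto[OF luc(2), where f = "\<lambda>g. blinfun_apply g z" and M = "norm z"])
          (use 2 nj False d blinfun_le[of _ z] in
            \<open>auto simp: linear_iff blinfun.add_left blinfun.scaleR_left mult.commute\<close>)
    qed
  qed
qed

text \<open>Monotonicity makes the pairing vanish, and \<open>duality_pair_tendsto\<close> for
  constant sequences identifies the points.\<close>

lemma duality_pair_strictly_monotone:
  fixes x y :: "'a::real_normed_vector"
  assumes luc: "locally_uniformly_convex TYPE('a)" "locally_uniformly_convex TYPE('a \<Rightarrow>\<^sub>L real)"
    and \<phi>: "gauge_function \<phi>"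
    and f: "duality_pair \<phi> x f" and g: "duality_pair \<phi> y g"
    and le: "blinfun_apply (f - g) (x - y) \<le> 0"
  shows "x = y"
proof -
  have "0 \<le> (\<phi> (norm x) - \<phi> (norm y)) * (norm x - norm y)"
    using gauge_product_nonneg[OF \<phi>] by simp
  also have "\<dots> \<le> blinfun_apply (f - g) (x - y)" by (rule duality_pair_monotone[OF f g])
  finally have "blinfun_apply (f - g) (x - y) = 0" using le by simp
  then have "(\<lambda>n::nat. x) \<longlonglongrightarrow> y"
    using duality_pair_tendsto[OF luc \<phi>, of "\<lambda>n. x" "\<lambda>n. f" y g] f g by simp
  then show ?thesis by (simp add: LIMSEQ_const_iff)
qed

section \<open>The generalized resolvent\<close>

text \<open>Substituting \<open>z = y - x\<close> moves the resolvent inclusion to the point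
  \<open>0\<close> and absorbs \<open>l\<close> into the operator.\<close>

lemma maximal_monotone_scale_shift:
  fixes A :: "'a::real_normed_vector \<Rightarrow> ('a \<Rightarrow>\<^sub>L real) set"
  assumes max: "maximal_monotone A" and l: "0 < l"
  shows "maximal_monotone (\<lambda>z. (*\<^sub>R) l ` A (z + x))"
proof -
  have mono: "\<And>y z u v. u \<in> A y \<Longrightarrow> v \<in> A z \<Longrightarrow> 0 \<le> blinfun_apply (u - v) (y - z)"
    and maxi: "\<And>y u. (\<And>z v. v \<in> A z \<Longrightarrow> 0 \<le> blinfun_apply (u - v) (y - z)) \<Longrightarrow> u \<in> A y"
    using max unfolding maximal_monotone_def monotone_op_def by blast+
  show ?thesis
    unfolding maximal_monotone_def monotone_op_def
  proof (intro conjI allI impI)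
    fix y z u v assume "u \<in> (*\<^sub>R) l ` A (y + x)" "v \<in> (*\<^sub>R) l ` A (z + x)"
    then obtain u' v' where uv: "u = l *\<^sub>R u'" "u' \<in> A (y + x)" "v = l *\<^sub>R v'" "v' \<in> A (z + x)"
      by blast
    have "blinfun_apply (u - v) (y - z) = l * blinfun_apply (u' - v') ((y + x) - (z + x))"
      by (simp add: uv blinfun.diff_left blinfun.scaleR_left right_diff_distrib)
    then show "0 \<le> blinfun_apply (u - v) (y - z)"
      using mono[OF uv(2,4)] l by simp
  next
    fix y u assume *: "\<forall>z v. v \<in> (*\<^sub>R) l ` A (z + x) \<longrightarrow> 0 \<le> blinfun_apply (u - v) (y - z)"
    have "(1 / l) *\<^sub>R u \<in> A (y + x)"
    proof (rule maxi)
      fix z v assume "v \<in> A z"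
      then have "l *\<^sub>R v \<in> (*\<^sub>R) l ` A (z - x + x)" by (simp add: imageI)
      then have "0 \<le> blinfun_apply (u - l *\<^sub>R v) (y - (z - x))" using * by blast
      also have "u - l *\<^sub>R v = l *\<^sub>R ((1 / l) *\<^sub>R u - v)" using l by (simp add: scaleR_diff_right)
      also have "y - (z - x) = y + x - z" by simp
      finally show "0 \<le> blinfun_apply ((1 / l) *\<^sub>R u - v) (y + x - z)"
        using l by (simp add: blinfun.scaleR_left zero_le_mult_iff)
    qed
    then have "l *\<^sub>R ((1 / l) *\<^sub>R u) \<in> (*\<^sub>R) l ` A (y + x)" by (rule imageI)
    then show "u \<in> (*\<^sub>R) l ` A (y + x)" using l by simp
  qed
qed

text \<open>This justifies the definite description of the resolvent: existence comes from the
  surjectivity theorem, uniqueness from strict monotonicity of duality pairs.\<close>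

lemma gen_yosida_in_gen_resolvent:
  fixes A :: "'a::real_normed_vector \<Rightarrow> ('a \<Rightarrow>\<^sub>L real) set"
  assumes refl: "reflexive_space TYPE('a)"
    and luc: "locally_uniformly_convex TYPE('a)" "locally_uniformly_convex TYPE('a \<Rightarrow>\<^sub>L real)"
    and max: "maximal_monotone A" and \<phi>: "gauge_function \<phi>" and l: "0 < l"
  shows "gen_yosida A \<phi> l x \<in> A (gen_resolvent A \<phi> l x)"
proof -
  note J = duality_pair_duality_map[OF luc(2) \<phi>]
  note J_unique = duality_pair_unique[OF luc(2) \<phi>]
  let ?P = "\<lambda>y. \<exists>u\<in>A y. duality_map \<phi> (y - x) + l *\<^sub>R u = 0"
  obtain w f where wf: "f \<in> (*\<^sub>R) l ` A (w + x)" "duality_pair \<phi> w (- f)"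
    using maximal_monotone_plus_duality_surjective[OF refl maximal_monotone_scale_shift[OF max l] \<phi>]
    by blast
  then obtain u where u: "f = l *\<^sub>R u" "u \<in> A (w + x)" by blast
  have "duality_map \<phi> w = - f" using J_unique[OF wf(2) J] .
  then have ex: "?P (w + x)" using u by (intro bexI[of _ u]) auto
  have "\<exists>!y. ?P y"
  proof (rule ex1I[of ?P, OF ex])
    fix y assume "?P y"
    then obtain v where v: "v \<in> A y" "duality_map \<phi> (y - x) + l *\<^sub>R v = 0" by blast
    then have "duality_map \<phi> (y - x) = - (l *\<^sub>R v)" by (simp add: eq_neg_iff_add_eq_0)
    with J[of "y - x"] have dv: "duality_pair \<phi> (y - x) (- (l *\<^sub>R v))" by simp
    have "0 \<le> blinfun_apply (v - u) (y - (w + x))"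
      using max v(1) u(2) unfolding maximal_monotone_def monotone_op_def by blast
    \<comment> \<open>The dual elements are \<open>- l\<close> times elements of the graph, so
      monotonicity of \<open>A\<close> gives the pairing the opposite sign.\<close>
    moreover have "blinfun_apply (- (l *\<^sub>R v) - (- f)) (y - x - w)
        = - (l * blinfun_apply (v - u) (y - (w + x)))"
      by (simp add: u blinfun.diff_left blinfun.minus_left blinfun.scaleR_left algebra_simps)
    ultimately have "blinfun_apply (- (l *\<^sub>R v) - (- f)) (y - x - w) \<le> 0" using l by simp
    then have "y - x = w" by (rule duality_pair_strictly_monotone[OF luc \<phi> dv wf(2)])
    then show "y = w + x" by (simp add: diff_eq_eq)
  qed
  then have "?P (gen_resolvent A \<phi> l x)"
    unfolding gen_resolvent_def by (rule theI')
  then obtain v where v: "v \<in> A (gen_resolvent A \<phi> l x)"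
    "duality_map \<phi> (gen_resolvent A \<phi> l x - x) + l *\<^sub>R v = 0" by blast
  \<comment> \<open>The resolvent is defined with \<open>x\<close> subtracted, the Yosida
    approximant with the resolvent subtracted; oddness links the two.\<close>
  have "duality_pair \<phi> (x - gen_resolvent A \<phi> l x) (- duality_map \<phi> (gen_resolvent A \<phi> l x - x))"
    using J[of "gen_resolvent A \<phi> l x - x"] duality_pair_uminus[of \<phi> "gen_resolvent A \<phi> l x - x"] by simp
  then have "duality_map \<phi> (x - gen_resolvent A \<phi> l x) = - duality_map \<phi> (gen_resolvent A \<phi> l x - x)"
    using J_unique J by blast
  also have "\<dots> = l *\<^sub>R v" using v(2) by (simp add: neg_eq_iff_add_eq_0)
  finally have "gen_yosida A \<phi> l x = v" using l by (simp add: gen_yosida_def)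
  then show ?thesis using v(1) by simp
qed

lemma monotone_duality_pair_tendsto:
  fixes A :: "'a::real_normed_vector \<Rightarrow> ('a \<Rightarrow>\<^sub>L real) set"
  assumes luc: "locally_uniformly_convex TYPE('a)" "locally_uniformly_convex TYPE('a \<Rightarrow>\<^sub>L real)"
    and mono: "monotone_op A" and \<phi>: "gauge_function \<phi>"
    and l: "lam \<longlonglongrightarrow> l" "0 < l" "\<And>n. 0 < lam n" and x: "xn \<longlonglongrightarrow> x"
    and pn: "\<And>n. duality_pair \<phi> (zn n) (jn n)" and p: "duality_pair \<phi> z j"
    and An: "\<And>n. (1 / lam n) *\<^sub>R jn n \<in> A (xn n - zn n)" and A: "(1 / l) *\<^sub>R j \<in> A (x - z)"
  shows "zn \<longlonglongrightarrow> z \<and> jn \<longlonglongrightarrow> j"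
proof (rule duality_pair_tendsto[OF luc \<phi> pn p])
  let ?r = "norm z" and ?rn = "\<lambda>n. norm (zn n)"
  define P where "P = \<phi> ?r"
  define D where "D n = blinfun_apply (jn n - j) (zn n - z)" for n
  define m where "m n = lam n / l" for n
  define a where "a n = norm (xn n - x)" for n
  have norms: "norm (jn n) = \<phi> (?rn n)" "norm j = P" for n
    using pn p by (auto simp: duality_pair_def P_def)
  have P: "0 \<le> P" using gauge_nonneg[OF \<phi>] by (simp add: P_def)
  have m: "m \<longlonglongrightarrow> 1" "\<And>n. 0 < m n"
    using tendsto_divide[OF l(1) tendsto_const[of l]] l by (auto simp: m_def [abs_def])
  have a: "a \<longlonglongrightarrow> 0"
    unfolding a_def using x by (simp add: tendsto_norm_zero LIM_zero)
  have lower: "(\<phi> (?rn n) - P) * (?rn n - ?r) \<le> D n" for n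
    unfolding D_def P_def by (rule duality_pair_monotone[OF pn p])
  have upper: "D n \<le> (\<phi> (?rn n) + m n * P) * a n + \<bar>m n - 1\<bar> * (P * (?rn n + ?r))" for n
  proof -
    let ?k = "jn n - m n *\<^sub>R j"
    have "0 \<le> blinfun_apply ((1 / lam n) *\<^sub>R jn n - (1 / l) *\<^sub>R j) ((xn n - zn n) - (x - z))"
      using mono An A unfolding monotone_op_def by blast
    \<comment> \<open>Multiplying by \<open>lam n\<close> leaves
      \<open>jn n - m n *\<^sub>R j\<close> with \<open>m n\<close> tending to \<open>1\<close>; the
      pairing is then \<open>- D n\<close> up to terms carrying \<open>xn n - x\<close> or
      \<open>m n - 1\<close>.\<close>
    then have "0 \<le> lam n * blinfun_apply ((1 / lam n) *\<^sub>R jn n - (1 / l) *\<^sub>R j) ((xn n - zn n) - (x - z))"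
      using l(3)[of n] by simp
    also have "\<dots> = blinfun_apply ?k ((xn n - zn n) - (x - z))"
      using l(3)[of n] by (simp add: m_def blinfun.diff_left blinfun.scaleR_left right_diff_distrib)
    also have "\<dots> = blinfun_apply ?k (xn n - x) - blinfun_apply ?k (zn n - z)"
      by (simp add: blinfun.diff_right)
    also have "blinfun_apply ?k (zn n - z) = D n - (m n - 1) * blinfun_apply j (zn n - z)"
      by (simp add: D_def blinfun.diff_left blinfun.scaleR_left left_diff_distrib)
    finally have "D n \<le> blinfun_apply ?k (xn n - x) + (m n - 1) * blinfun_apply j (zn n - z)" by simp
    also have "\<dots> \<le> norm ?k * a n + \<bar>m n - 1\<bar> * \<bar>blinfun_apply j (zn n - z)\<bar>"
      using blinfun_le[of ?k "xn n - x"] abs_ge_self[of "(m n - 1) * blinfun_apply j (zn n - z)"]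
      by (simp add: a_def abs_mult)
    also have "\<dots> \<le> (\<phi> (?rn n) + m n * P) * a n + \<bar>m n - 1\<bar> * (P * (?rn n + ?r))"
    proof (intro add_mono mult_left_mono mult_right_mono)
      show "norm ?k \<le> \<phi> (?rn n) + m n * P"
        using norm_triangle_ineq4[of "jn n" "m n *\<^sub>R j"] m(2)[of n] by (simp add: norms)
      have "\<bar>blinfun_apply j (zn n - z)\<bar> \<le> P * norm (zn n - z)"
        using blinfun_abs_le[of j "zn n - z"] by (simp add: norms)
      also have "\<dots> \<le> P * (?rn n + ?r)"
        using P by (intro mult_left_mono norm_triangle_ineq4)
      finally show "\<bar>blinfun_apply j (zn n - z)\<bar> \<le> P * (?rn n + ?r)" .
    qed (auto simp: a_def)
    finally show ?thesis .
  qed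
  \<comment> \<open>For \<open>s = norm (zn n)\<close> the lower bound of \<open>D n\<close> grows
    like \<open>\<phi> s * s\<close>, the upper one only like \<open>\<phi> s + s\<close>. Beyond
    \<open>R\<close>, the estimate \<open>\<phi> s \<le> 2 * P * (?r + 3)\<close> derived below is
    impossible; the \<open>+ 1\<close> supplies strictness.\<close>
  have "\<forall>\<^sub>F s in at_top. 2 * P * (?r + 3) + 1 \<le> \<phi> s"
    using \<phi> by (simp add: gauge_function_def filterlim_at_top)
  then obtain R where R: "\<And>s. R \<le> s \<Longrightarrow> 2 * P * (?r + 3) + 1 \<le> \<phi> s"
    by (auto simp: eventually_at_top_linorder)
  \<comment> \<open>The second entry ensures \<open>q \<ge> 1\<close> below.\<close>
  define B where "B = max R (?r + 2)"
  have ev: "\<forall>\<^sub>F n in sequentially. a n < 1 \<and> \<bar>m n - 1\<bar> < 1"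
    using order_tendstoD(2)[OF a, of 1] tendstoD[OF m(1), of 1]
    by (simp add: eventually_conj_iff dist_real_def)
  have upper': "\<forall>\<^sub>F n in sequentially. D n \<le> (\<phi> B + 2 * P) * a n + \<bar>m n - 1\<bar> * (P * (B + ?r))"
    using ev
  proof eventually_elim
    case (elim n)
    have mP: "m n * P \<le> 2 * P" using elim P by (intro mult_right_mono) auto
    have \<phi>n: "0 \<le> \<phi> (?rn n)" using gauge_nonneg[OF \<phi>] by simp
    have rn: "?rn n \<le> B"
    proof (rule ccontr)
      assume "\<not> ?rn n \<le> B"
      then have big: "R \<le> ?rn n" "?r + 2 \<le> ?rn n" by (auto simp: B_def)
      \<comment> \<open>This is the factor left on \<open>\<phi> (?rn n)\<close> once the bounds for
        \<open>D n\<close> are combined and its occurrences are collected.\<close>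
      define q where "q = ?rn n - ?r - 1"
      have q: "1 \<le> q" using big by (simp add: q_def)
      have "(\<phi> (?rn n) + m n * P) * a n \<le> (\<phi> (?rn n) + 2 * P) * 1"
        using elim mP \<phi>n P by (intro mult_mono) (auto simp: a_def)
      moreover have "\<bar>m n - 1\<bar> * (P * (?rn n + ?r)) \<le> 1 * (P * (?rn n + ?r))"
        using elim P by (intro mult_right_mono) auto
      ultimately have "(\<phi> (?rn n) - P) * (?rn n - ?r) \<le> \<phi> (?rn n) + 2 * P + P * (?rn n + ?r)"
        using lower[of n] upper[of n] by simp
      then have "\<phi> (?rn n) * q \<le> 2 * P * (q + ?r + 2)"
        by (simp add: q_def algebra_simps)
      also have "\<dots> \<le> 2 * P * (q * (?r + 3))"
      proof (intro mult_left_mono)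
        have "1 * (?r + 2) \<le> q * (?r + 2)" using q by (intro mult_right_mono) auto
        then show "q + ?r + 2 \<le> q * (?r + 3)" by (simp add: algebra_simps)
      qed (use P in simp)
      finally have "\<phi> (?rn n) * q \<le> (2 * P * (?r + 3)) * q" by (simp add: ac_simps)
      then have "\<phi> (?rn n) \<le> 2 * P * (?r + 3)" using q by simp
      then show False using R[OF big(1)] by simp
    qed
    have "\<phi> (?rn n) \<le> \<phi> B" using gauge_mono[OF \<phi> _ rn] by simp
    then have "(\<phi> (?rn n) + m n * P) * a n \<le> (\<phi> B + 2 * P) * a n"
      using mP by (intro mult_right_mono) (auto simp: a_def)
    moreover have "\<bar>m n - 1\<bar> * (P * (?rn n + ?r)) \<le> \<bar>m n - 1\<bar> * (P * (B + ?r))"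
      using rn P by (intro mult_left_mono) auto
    ultimately show ?case using upper[of n] by simp
  qed
  have "(\<lambda>n. (\<phi> B + 2 * P) * a n + \<bar>m n - 1\<bar> * (P * (B + ?r)))
      \<longlonglongrightarrow> (\<phi> B + 2 * P) * 0 + \<bar>1 - 1\<bar> * (P * (B + ?r))"
    by (intro tendsto_add tendsto_mult tendsto_rabs tendsto_diff tendsto_const a m(1))
  then have lim: "(\<lambda>n. (\<phi> B + 2 * P) * a n + \<bar>m n - 1\<bar> * (P * (B + ?r))) \<longlonglongrightarrow> 0" by simp
  have nonneg: "0 \<le> D n" for n
  proof -
    have "0 \<le> (\<phi> (?rn n) - P) * (?rn n - ?r)"
      using gauge_product_nonneg[OF \<phi>] by (simp add: P_def)
    then show ?thesis using lower[of n] by simp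
  qed
  have "D \<longlonglongrightarrow> 0"
    by (rule tendsto_sandwich[OF _ upper' tendsto_const lim]) (simp add: nonneg)
  then show "(\<lambda>n. blinfun_apply (jn n - j) (zn n - z)) \<longlonglongrightarrow> 0" by (simp add: D_def [abs_def])
qed

theorem theorem3:
  fixes A :: "'a::banach \<Rightarrow> ('a \<Rightarrow>\<^sub>L real) set" and \<phi> :: "real \<Rightarrow> real"
  assumes "reflexive_space TYPE('a)"
    and "locally_uniformly_convex TYPE('a)"
    and "locally_uniformly_convex TYPE('a \<Rightarrow>\<^sub>L real)"
    and "maximal_monotone A"
    and "gauge_function \<phi>"
  shows "continuous_on ({0<..} \<times> UNIV) (\<lambda>(l, x). gen_yosida A \<phi> l x) \<and>
         continuous_on ({0<..} \<times> UNIV) (\<lambda>(l, x). gen_resolvent A \<phi> l x)"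
proof -
  let ?z = "\<lambda>l x. x - gen_resolvent A \<phi> l x"
  let ?j = "\<lambda>l x. duality_map \<phi> (?z l x)"
  have J: "duality_pair \<phi> x (duality_map \<phi> x)" for x :: 'a
    using assms(3,5) by (rule duality_pair_duality_map)
  have A: "(1 / l) *\<^sub>R ?j l x \<in> A (x - ?z l x)" if "0 < l" for l x
    using gen_yosida_in_gen_resolvent[OF assms that, of x] by (simp add: gen_yosida_def)
  have mono: "monotone_op A" using assms(4) by (simp add: maximal_monotone_def)
  have key: "(\<lambda>n. gen_yosida A \<phi> (lam n) (xn n)) \<longlonglongrightarrow> gen_yosida A \<phi> l x \<and>
      (\<lambda>n. gen_resolvent A \<phi> (lam n) (xn n)) \<longlonglongrightarrow> gen_resolvent A \<phi> l x"
    if l: "lam \<longlonglongrightarrow> l" "0 < l" "\<And>n. 0 < lam n" and x: "xn \<longlonglongrightarrow> x" for lam :: "nat \<Rightarrow> real" and l xn x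
  proof -
    have lim: "(\<lambda>n. ?z (lam n) (xn n)) \<longlonglongrightarrow> ?z l x \<and> (\<lambda>n. ?j (lam n) (xn n)) \<longlonglongrightarrow> ?j l x"
      by (rule monotone_duality_pair_tendsto[OF assms(2,3) mono assms(5) l x J J A[OF l(3)] A[OF l(2)]])
    have "(\<lambda>n. (1 / lam n) *\<^sub>R ?j (lam n) (xn n)) \<longlonglongrightarrow> (1 / l) *\<^sub>R ?j l x"
      using lim l by (intro tendsto_scaleR tendsto_divide tendsto_const) auto
    moreover have "(\<lambda>n. xn n - ?z (lam n) (xn n)) \<longlonglongrightarrow> x - ?z l x"
      by (rule tendsto_diff[OF x conjunct1[OF lim]])
    ultimately show ?thesis by (simp add: gen_yosida_def)
  qed
  have "(\<lambda>n. gen_yosida A \<phi> (fst (u n)) (snd (u n))) \<longlonglongrightarrow> gen_yosida A \<phi> (fst a) (snd a) \<and>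
      (\<lambda>n. gen_resolvent A \<phi> (fst (u n)) (snd (u n))) \<longlonglongrightarrow> gen_resolvent A \<phi> (fst a) (snd a)"
    if "u \<longlonglongrightarrow> a" "a \<in> {0<..} \<times> UNIV" "\<And>n. u n \<in> {0<..} \<times> UNIV" for u :: "nat \<Rightarrow> real \<times> 'a" and a
    using that by (intro key tendsto_fst tendsto_snd) (auto simp: mem_Times_iff)
  then show ?thesis
    unfolding continuous_on_sequentially comp_def case_prod_unfold by blast
qed

end
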